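(* Let $n\geq3$, let $p,q\geq0$ satisfy $3p+3q=1$, and let $N$ be a positive integer such that $pN$ and $qN$ are integers. Let $P$ be the probability distribution on the six blocks in the support of the Coppersmith–Winograd tensor $CW_n$ assigning $p$ to each of the three large blocks and $q$ to each of the three small blocks. Then the rank of the sweet piece $SP_{P,N}(CW_n)$ is smaller than $$n^N-\binom{N}{(2p+2q)N+1}(n-1)^{(p+q)N-1}.$$ In particular, it is smaller than the border rank of $(CW_n)^{\boxtimes N}$.
   Context: $\mathbb{K}$ is an algebraically closed field of characteristic zero; rank and border rank of 3-way tensors are the usual tensor rank and border rank, and $\boxtimes$ denotes the Kronecker product of 3-way tensors (a power $T^{\boxtimes N}$ of $T\in V_1\otimes V_2\otimes V_3$ lies in $V_1^{\otimes N}\otimes V_2^{\otimes N}\otimes V_3^{\otimes N}$). $CW_n\in\mathbb{K}^n\otimes\mathbb{K}^n\otimes\mathbb{K}^n$ is $$CW_n=\sum_{i=1}^ne_1\otimes e_i\otimes e_i+\sum_{i=2}^ne_i\otimes e_1\otimes e_i+\sum_{i=2}^{n-1}e_i\otimes e_i\otimes e_n.$$ Blocking: in the first and second factor label $e_1\mapsto-2$, $e_2,\ldots,e_{n-1}\mapsto1$, $e_n\mapsto4$; in the third factor label $e_n\mapsto-2$, $e_2,\ldots,e_{n-1}\mapsto1$, $e_1\mapsto4$. The block of $CW_n$ with index $(a_1,a_2,a_3)$ is its projection to the span of $e_i\otimes e_j\otimes e_k$ with labels $a_1,a_2,a_3$. The nonzero blocks are the three "large" blocks, indexed by the permutations of $(-2,1,1)$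 (two factors of dimension $n-2$, one of dimension $1$), and the three "small" $1\times1\times1$ blocks, indexed by the permutations of $(-2,-2,4)$. Each of the three marginals of $P$ assigns $p+2q$, $2p$, $q$ to the labels $-2,1,4$ respectively. $SP_{P,N}(CW_n)$ is the image of $(CW_n)^{\boxtimes N}$ under the coordinate projection which, in each of the three factors $(\mathbb{K}^n)^{\otimes N}$, keeps exactly the basis vectors $e_{i_1}\otimes\cdots\otimes e_{i_N}$ whose sequence of labels contains $-2$ exactly $(p+2q)N$ times, $1$ exactly $2pN$ times and $4$ exactly $qN$ times (and sends the other basis vectors to zero). *)

theory Defs
  imports "HOL-Probability.Probability" "HOL-Computational_Algebra.Polynomial"
begin

text \<open>
  A tensor in \<open>K\<^sup>I \<otimes> K\<^sup>J \<otimes> K\<^sup>L\<close> (with \<open>I\<close>, \<open>J\<close>, \<open>L\<close> finite) is given by its coordinates in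
  the standard basis. The index sets are explicit arguments of the notions below, which do not
  depend on the values of the coordinate function outside of \<open>I \<times> J \<times> L\<close>.
\<close>

type_synonym ('i, 'j, 'l, 'k) tensor3 = "'i \<Rightarrow> 'j \<Rightarrow> 'l \<Rightarrow> 'k"

definition rank_le ::
  "'i set \<Rightarrow> 'j set \<Rightarrow> 'l set \<Rightarrow> ('i, 'j, 'l, 'k::field) tensor3 \<Rightarrow> nat \<Rightarrow> bool" where
  "rank_le I J L T r \<longleftrightarrow>
     (\<exists>(u :: nat \<Rightarrow> 'i \<Rightarrow> 'k) (v :: nat \<Rightarrow> 'j \<Rightarrow> 'k) (w :: nat \<Rightarrow> 'l \<Rightarrow> 'k).
        \<forall>i\<in>I. \<forall>j\<in>J. \<forall>l\<in>L. T i j l = (\<Sum>s<r. u s i * v s j * w s l))"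

definition tensor_rank ::
  "'i set \<Rightarrow> 'j set \<Rightarrow> 'l set \<Rightarrow> ('i, 'j, 'l, 'k::field) tensor3 \<Rightarrow> nat" where
  "tensor_rank I J L T = (LEAST r. rank_le I J L T r)"

text \<open>The polynomial functions on the affine space \<open>K\<^sup>I \<otimes> K\<^sup>J \<otimes> K\<^sup>L\<close>.\<close>

inductive_set polynomial_functions ::
  "'i set \<Rightarrow> 'j set \<Rightarrow> 'l set \<Rightarrow> (('i, 'j, 'l, 'k::field) tensor3 \<Rightarrow> 'k) set"
  for I J L where
  const: "(\<lambda>T. c) \<in> polynomial_functions I J L"
| coord: "i \<in> I \<Longrightarrow> j \<in> J \<Longrightarrow> l \<in> L \<Longrightarrow> (\<lambda>T. T i j l) \<in> polynomial_functions I J L"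
| add: "f \<in> polynomial_functions I J L \<Longrightarrow> g \<in> polynomial_functions I J L \<Longrightarrow>
          (\<lambda>T. f T + g T) \<in> polynomial_functions I J L"
| mult: "f \<in> polynomial_functions I J L \<Longrightarrow> g \<in> polynomial_functions I J L \<Longrightarrow>
          (\<lambda>T. f T * g T) \<in> polynomial_functions I J L"

definition zariski_closure ::
  "'i set \<Rightarrow> 'j set \<Rightarrow> 'l set \<Rightarrow> ('i, 'j, 'l, 'k::field) tensor3 set \<Rightarrow> ('i, 'j, 'l, 'k) tensor3 set"
  where
  "zariski_closure I J L X =
     {T. \<forall>f\<in>polynomial_functions I J L. (\<forall>S\<in>X. f S = 0) \<longrightarrow> f T = 0}"

definition border_rank ::
  "'i set \<Rightarrow> 'j set \<Rightarrow> 'l set \<Rightarrow> ('i, 'j, 'l, 'k::field) tensor3 \<Rightarrow> nat" where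
  "border_rank I J L T = (LEAST r. T \<in> zariski_closure I J L {S. tensor_rank I J L S \<le> r})"

definition kronecker ::
  "('i, 'j, 'l, 'k::field) tensor3 \<Rightarrow> ('i2, 'j2, 'l2, 'k) tensor3 \<Rightarrow>
     ('i \<times> 'i2, 'j \<times> 'j2, 'l \<times> 'l2, 'k) tensor3" where
  "kronecker S T = (\<lambda>(i, i') (j, j') (l, l'). S i j l * T i' j' l')"

text \<open>
  The basis vector \<open>e\<^sub>x\<^sub>1 \<otimes> \<dots> \<otimes> e\<^sub>x\<^sub>N\<close> of a tensor power is indexed by the list \<open>[x\<^sub>1, \<dots>, x\<^sub>N]\<close>.
\<close>

definition power_index :: "'i set \<Rightarrow> nat \<Rightarrow> 'i list set" where
  "power_index I N = {xs. length xs = N \<and> set xs \<subseteq> I}"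

definition kronecker_power ::
  "('i, 'j, 'l, 'k::field) tensor3 \<Rightarrow> nat \<Rightarrow> ('i list, 'j list, 'l list, 'k) tensor3" where
  "kronecker_power T N = (\<lambda>xs ys zs. \<Prod>m<N. T (xs ! m) (ys ! m) (zs ! m))"

lemma kronecker_power_0: "kronecker_power T 0 [] [] [] = 1"
  by (simp add: kronecker_power_def)

lemma kronecker_power_Suc:
  "kronecker_power T (Suc N) (x # xs) (y # ys) (z # zs) =
     kronecker T (kronecker_power T N) (x, xs) (y, ys) (z, zs)"
  by (simp add: kronecker_power_def kronecker_def prod.lessThan_Suc_shift del: prod.lessThan_Suc)

definition basis_tensor :: "'i \<Rightarrow> 'j \<Rightarrow> 'l \<Rightarrow> ('i, 'j, 'l, 'k::field) tensor3" where
  "basis_tensor i j l = (\<lambda>x y z. if x = i \<and> y = j \<and> z = l then 1 else 0)"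

definition CW :: "nat \<Rightarrow> (nat, nat, nat, 'k::field) tensor3" where
  "CW n = (\<lambda>x y z.
     (\<Sum>i=1..n. basis_tensor 1 i i x y z)
   + (\<Sum>i=2..n. basis_tensor i 1 i x y z)
   + (\<Sum>i=2..n-1. basis_tensor i i n x y z))"

definition label12 :: "nat \<Rightarrow> nat \<Rightarrow> int" where
  "label12 n i = (if i = 1 then -2 else if i = n then 4 else 1)"

definition label3 :: "nat \<Rightarrow> nat \<Rightarrow> int" where
  "label3 n i = (if i = n then -2 else if i = 1 then 4 else 1)"

definition CW_block :: "nat \<Rightarrow> int \<times> int \<times> int \<Rightarrow> (nat, nat, nat, 'k::field) tensor3" where
  "CW_block n = (\<lambda>(a1, a2, a3) x y z.
     if label12 n x = a1 \<and> label12 n y = a2 \<and> label3 n z = a3 then CW n x y z else 0)"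

definition large_blocks :: "(int \<times> int \<times> int) set" where
  "large_blocks = {(-2, 1, 1), (1, -2, 1), (1, 1, -2)}"

definition small_blocks :: "(int \<times> int \<times> int) set" where
  "small_blocks = {(-2, -2, 4), (-2, 4, -2), (4, -2, -2)}"

lemma CW_eq:
  "CW n x y z =
     (if x = 1 \<and> y = z \<and> y \<in> {1..n} \<or> y = 1 \<and> x = z \<and> x \<in> {2..n}
        \<or> z = n \<and> x = y \<and> x \<in> {2..n-1} then 1 else (0::'k::field))"
proof -
  have 1: "(\<Sum>i=1..n. basis_tensor 1 i i x y z) =
             (if x = 1 \<and> y = z \<and> y \<in> {1..n} then 1 else (0::'k))"
  proof -
    have "(\<Sum>i=1..n. basis_tensor 1 i i x y z) =
            (\<Sum>i=1..n. if i = y then (if x = 1 \<and> y = z then 1 else (0::'k)) else 0)"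
      by (intro sum.cong) (auto simp: basis_tensor_def)
    thus ?thesis by simp
  qed
  have 2: "(\<Sum>i=2..n. basis_tensor i 1 i x y z) =
             (if y = 1 \<and> x = z \<and> x \<in> {2..n} then 1 else (0::'k))"
  proof -
    have "(\<Sum>i=2..n. basis_tensor i 1 i x y z) =
            (\<Sum>i=2..n. if i = x then (if y = 1 \<and> x = z then 1 else (0::'k)) else 0)"
      by (intro sum.cong) (auto simp: basis_tensor_def)
    thus ?thesis by simp
  qed
  have 3: "(\<Sum>i=2..n-1. basis_tensor i i n x y z) =
             (if z = n \<and> x = y \<and> x \<in> {2..n-1} then 1 else (0::'k))"
  proof -
    have "(\<Sum>i=2..n-1. basis_tensor i i n x y z) =
            (\<Sum>i=2..n-1. if i = x then (if z = n \<and> x = y then 1 else (0::'k)) else 0)"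
      by (intro sum.cong) (auto simp: basis_tensor_def)
    thus ?thesis by simp
  qed
  have ind: "(if A then 1 else 0) + (if B then 1 else 0) + (if C then 1 else 0) =
               (if A \<or> B \<or> C then 1 else (0::'k))"
    if "\<not> (A \<and> B)" "\<not> (A \<and> C)" "\<not> (B \<and> C)" for A B C
    using that by (cases A; cases B; cases C) simp_all
  show ?thesis
    unfolding CW_def 1 2 3 by (rule ind) auto
qed

lemma CW_nonzero_blocks:
  assumes n: "n \<ge> 3"
  shows "{a. \<exists>x\<in>{1..n}. \<exists>y\<in>{1..n}. \<exists>z\<in>{1..n}. CW_block n a x y z \<noteq> (0::'k::field)} =
           large_blocks \<union> small_blocks" (is "?A = ?B")
proof
  have "a \<in> ?B" if ne: "CW_block n a x y z \<noteq> (0::'k)" for a x y z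
  proof -
    obtain a1 a2 a3 where a: "a = (a1, a2, a3)" by (cases a)
    have l: "a1 = label12 n x" "a2 = label12 n y" "a3 = label3 n z" and c: "CW n x y z \<noteq> (0::'k)"
      using ne by (simp_all add: a CW_block_def split: if_splits)
    have "x = 1 \<and> y = z \<and> y \<in> {1..n} \<or> y = 1 \<and> x = z \<and> x \<in> {2..n}
            \<or> z = n \<and> x = y \<and> x \<in> {2..n-1}"
      by (rule ccontr) (use c in \<open>simp only: CW_eq if_False simp_thms\<close>)
    then consider "x = 1" "z = y" "y = 1" | "x = 1" "z = y" "y = n"
      | "x = 1" "z = y" "y \<noteq> 1" "y \<noteq> n" | "y = 1" "z = x" "x = n"
      | "y = 1" "z = x" "x \<noteq> 1" "x \<noteq> n" | "z = n" "y = x" "x \<noteq> 1" "x \<noteq> n"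
      using n by fastforce
    thus ?thesis
      by cases (use n in \<open>simp_all add: a l label12_def label3_def large_blocks_def small_blocks_def\<close>)
  qed
  thus "?A \<subseteq> ?B" by blast
  have *: "a \<in> ?A" if "CW_block n a x y z \<noteq> (0::'k)" "x \<in> {1..n}" "y \<in> {1..n}" "z \<in> {1..n}"
    for a x y z using that by blast
  note defs = CW_block_def CW_eq label12_def label3_def
  have "(-2, 1, 1) \<in> ?A" by (rule *[of _ 1 2 2]) (use n in \<open>auto simp: defs\<close>)
  moreover have "(1, -2, 1) \<in> ?A" by (rule *[of _ 2 1 2]) (use n in \<open>auto simp: defs\<close>)
  moreover have "(1, 1, -2) \<in> ?A" by (rule *[of _ 2 2 n]) (use n in \<open>auto simp: defs\<close>)
  moreover have "(-2, -2, 4) \<in> ?A" by (rule *[of _ 1 1 1]) (use n in \<open>auto simp: defs\<close>)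
  moreover have "(-2, 4, -2) \<in> ?A" by (rule *[of _ 1 n n]) (use n in \<open>auto simp: defs\<close>)
  moreover have "(4, -2, -2) \<in> ?A" by (rule *[of _ n 1 n]) (use n in \<open>auto simp: defs\<close>)
  ultimately show "?B \<subseteq> ?A"
    unfolding large_blocks_def small_blocks_def by blast
qed

text \<open>The frequencies of the labels along \<open>xs\<close> are exactly those given by \<open>Q\<close>.\<close>

definition has_label_type :: "('i \<Rightarrow> int) \<Rightarrow> int pmf \<Rightarrow> nat \<Rightarrow> 'i list \<Rightarrow> bool" where
  "has_label_type lab Q N xs \<longleftrightarrow> (\<forall>a. real (count_list (map lab xs) a) = pmf Q a * real N)"

definition sweet_piece ::
  "(int \<times> int \<times> int) pmf \<Rightarrow> nat \<Rightarrow> nat \<Rightarrow> (nat list, nat list, nat list, 'k::field) tensor3" where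
  "sweet_piece P N n = (\<lambda>xs ys zs.
     if has_label_type (label12 n) (map_pmf fst P) N xs
      \<and> has_label_type (label12 n) (map_pmf (fst \<circ> snd) P) N ys
      \<and> has_label_type (label3 n) (map_pmf (snd \<circ> snd) P) N zs
     then kronecker_power (CW n) N xs ys zs else 0)"

definition CW_distribution :: "real \<Rightarrow> real \<Rightarrow> (int \<times> int \<times> int) pmf \<Rightarrow> bool" where
  "CW_distribution p q P \<longleftrightarrow>
     set_pmf P \<subseteq> large_blocks \<union> small_blocks \<and>
     (\<forall>a\<in>large_blocks. pmf P a = p) \<and> (\<forall>a\<in>small_blocks. pmf P a = q)"

lemma CW_distribution_marginals:
  assumes P: "CW_distribution p q P" and f: "f \<in> {fst, fst \<circ> snd, snd \<circ> snd}"
  shows "pmf (map_pmf f P) (-2) = p + 2 * q"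
    and "pmf (map_pmf f P) 1 = 2 * p"
    and "pmf (map_pmf f P) 4 = q"
proof -
  let ?B = "large_blocks \<union> small_blocks"
  have fin: "finite ?B"
    by (simp add: large_blocks_def small_blocks_def)
  have *: "pmf (map_pmf f P) c = (\<Sum>a\<in>?B. if f a = c then pmf P a else 0)" for c
  proof -
    have "pmf (map_pmf f P) c = measure (measure_pmf P) (f -` {c})"
      by (simp add: pmf_map)
    also have "\<dots> = measure (measure_pmf P) (f -` {c} \<inter> set_pmf P)"
      by (simp add: measure_Int_set_pmf)
    also have "\<dots> = measure (measure_pmf P) (f -` {c} \<inter> ?B)"
      using P by (intro measure_prob_cong_0)
        (auto simp: CW_distribution_def set_pmf_iff)
    also have "\<dots> = sum (pmf P) (f -` {c} \<inter> ?B)"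
      using fin by (intro measure_measure_pmf_finite) auto
    also have "\<dots> = (\<Sum>a\<in>?B. if f a = c then pmf P a else 0)"
      using fin by (simp add: sum.inter_filter[symmetric] Int_def vimage_def conj_commute)
    finally show ?thesis .
  qed
  have B: "?B = {(-2, 1, 1), (1, -2, 1), (1, 1, -2), (-2, -2, 4), (-2, 4, -2), (4, -2, -2)}"
    by (auto simp: large_blocks_def small_blocks_def)
  have P': "pmf P (-2, 1, 1) = p" "pmf P (1, -2, 1) = p" "pmf P (1, 1, -2) = p"
    "pmf P (-2, -2, 4) = q" "pmf P (-2, 4, -2) = q" "pmf P (4, -2, -2) = q"
    using P by (simp_all add: CW_distribution_def large_blocks_def small_blocks_def)
  have f': "f = fst \<or> f = fst \<circ> snd \<or> f = snd \<circ> snd"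
    using f by blast
  show "pmf (map_pmf f P) (-2) = p + 2 * q"
    using f' unfolding * B by (elim disjE) (simp_all add: P')
  show "pmf (map_pmf f P) 1 = 2 * p"
    using f' unfolding * B by (elim disjE) (simp_all add: P')
  show "pmf (map_pmf f P) 4 = q"
    using f' unfolding * B by (elim disjE) (simp_all add: P')
qed

end

(*
  Read with the third factor dualised, CW_n is the multiplication of a graded algebra with
  Hilbert function (1, n - 2, 1), and the blocking is its grading. This algebra is the associated
  graded of a filtration on the algebra of functions on n points, so graded pieces of its N-th
  power are computed by pointwise multiplication on n^N points. The sweet piece multiplies
  degree 2N/3 by degree 2N/3, so the products lie in the space of functions of degree at most
  4N/3. As many points as the dimension of this space suffice to determine its elements, and
  there are more basis functions of larger degree than the subtracted term, which counts those
  with exactly 2N/3 + 1 factors of degree 2.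
  Since CW_n has the identity matrix as a slice, so has its power, whose border rank is
  therefore at least n^N.
*)

theory Submission
  imports Defs "Jordan_Normal_Form.Determinant"
begin

section \<open>Rank and border rank\<close>

lemma rank_le_sum:
  assumes "finite Y"
    and "\<And>i j l. i \<in> I \<Longrightarrow> j \<in> J \<Longrightarrow> l \<in> L \<Longrightarrow> T i j l = (\<Sum>s\<in>Y. u s i * v s j * w s l)"
  shows "rank_le I J L T (card Y)"
proof -
  obtain h where h: "bij_betw h {..<card Y} Y"
    using ex_bij_betw_nat_finite[OF assms(1)] atLeast0LessThan by metis
  have "T i j l = (\<Sum>s<card Y. u (h s) i * v (h s) j * w (h s) l)"
    if "i \<in> I" "j \<in> J" "l \<in> L" for i j l
    using that assms(2) sum.reindex_bij_betw[OF h, of "\<lambda>s. u s i * v s j * w s l"] by simp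
  then show ?thesis
    unfolding rank_le_def
    by (intro exI[of _ "\<lambda>s. u (h s)"] exI[of _ "\<lambda>s. v (h s)"] exI[of _ "\<lambda>s. w (h s)"]) blast
qed

lemma tensor_rank_le: "rank_le I J L T r \<Longrightarrow> tensor_rank I J L T \<le> r"
  unfolding tensor_rank_def by (rule Least_le)

text \<open>Splitting a tensor into its fibres over the pairs \<open>(i, j)\<close> writes it as a
  finite sum of rank-one tensors, so the minimum defining \<open>tensor_rank\<close> is
  attained.\<close>

lemma rank_le_tensor_rank:
  assumes "finite I" "finite J"
  shows "rank_le I J L T (tensor_rank I J L T)"
proof -
  have "rank_le I J L T (card (I \<times> J))"
  proof (rule rank_le_sum)
    fix i j l assume ij: "i \<in> I" "j \<in> J"
    have "(\<Sum>s\<in>I \<times> J. (if i = fst s then 1 else 0) * (if j = snd s then 1 else 0) * T (fst s) (snd s) l)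
        = (\<Sum>s\<in>I \<times> J. if s = (i, j) then T i j l else 0)"
      by (intro sum.cong) auto
    also have "\<dots> = T i j l"
      using assms ij by simp
    finally show "T i j l = (\<Sum>s\<in>I \<times> J. (if i = fst s then 1 else 0) * (if j = snd s then 1 else 0)
        * T (fst s) (snd s) l)" by simp
  qed (use assms in auto)
  then show ?thesis
    unfolding tensor_rank_def by (rule LeastI)
qed

section \<open>Lower bound for the border rank from a slice\<close>

lemma polynomial_functions_sum:
  assumes "finite A" "\<And>a. a \<in> A \<Longrightarrow> f a \<in> polynomial_functions I J L"
  shows "(\<lambda>T. \<Sum>a\<in>A. f a T) \<in> polynomial_functions I J L"
  using assms by (induction A rule: finite_induct) (auto intro: polynomial_functions.intros)

lemma polynomial_functions_prod:
  assumes "finite A" "\<And>a. a \<in> A \<Longrightarrow> f a \<in> polynomial_functions I J L"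
  shows "(\<lambda>T. \<Prod>a\<in>A. f a T) \<in> polynomial_functions I J L"
  using assms by (induction A rule: finite_induct) (auto intro: polynomial_functions.intros)

text \<open>The matrix factors through a space of dimension \<open>r\<close>. Padding both factors
  with zeros to size \<open>m\<close> leaves a zero last row in \<open>B\<close>, so
  multiplicativity of the determinant gives 0.\<close>

lemma det_low_rank:
  fixes a :: "nat \<Rightarrow> nat \<Rightarrow> 'a::field"
  assumes "r < m"
  shows "det (mat m m (\<lambda>(i, j). \<Sum>s<r. a s i * b s j)) = 0"
proof -
  define A where "A = mat m m (\<lambda>(i, s). if s < r then a s i else 0)"
  define B where "B = mat m m (\<lambda>(s, j). if s < r then b s j else 0)"
  have A: "A \<in> carrier_mat m m" and B: "B \<in> carrier_mat m m"
    by (auto simp: A_def B_def)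
  have "mat m m (\<lambda>(i, j). \<Sum>s<r. a s i * b s j) = A * B"
  proof (rule eq_matI)
    fix i j assume "i < dim_row (A * B)" "j < dim_col (A * B)"
    then have ij: "i < m" "j < m" using A B by auto
    have "(A * B) $$ (i, j) = (\<Sum>s\<in>{0..<m}. if s < r then a s i * b s j else 0)"
      using ij by (auto simp: A_def B_def scalar_prod_def intro!: sum.cong)
    also have "\<dots> = (\<Sum>s<r. a s i * b s j)"
      using assms by (intro sum.mono_neutral_cong_right) auto
    finally show "mat m m (\<lambda>(i, j). \<Sum>s<r. a s i * b s j) $$ (i, j) = (A * B) $$ (i, j)"
      using ij by simp
  qed (use A B in auto)
  moreover have "B = mat\<^sub>r m m (\<lambda>s. if s = m - 1 then 0\<^sub>v m else row B s)"
    using assms by (intro eq_matI) (auto simp: B_def)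
  then have "det B = 0"
    using det_row_0[of "m - 1" m "row B"] assms B by fastforce
  ultimately show ?thesis
    using det_mult[OF A B] by simp
qed

text \<open>The determinant of the slice at \<open>e\<close> is a polynomial function. It vanishes
  on tensors of rank below \<open>card J\<close>, whose slices are sums of too few rank-one
  matrices, hence on the closure of this set; but it equals 1 at \<open>T\<close>.\<close>

lemma border_rank_ge_identity_slice:
  fixes T :: "('i, 'j, 'j, 'k::field) tensor3"
  assumes fin: "finite I" "finite J" and e: "e \<in> I"
    and slice: "\<And>j l. j \<in> J \<Longrightarrow> l \<in> J \<Longrightarrow> T e j l = (if j = l then 1 else 0)"
  shows "card J \<le> border_rank I J J T"
proof (rule ccontr)
  define m where "m = card J"
  define R where "R = border_rank I J J T"
  assume "\<not> ?thesis"
  then have Rm: "R < m" by (simp add: m_def R_def)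
  obtain h where h: "bij_betw h {0..<m} J"
    unfolding m_def using ex_bij_betw_nat_finite[OF fin(2)] by blast
  have hJ: "h i \<in> J" if "i < m" for i
    using h that by (auto simp: bij_betw_def)
  define F where "F S = det (mat m m (\<lambda>(i, j). S e (h i) (h j)))"
    for S :: "('i, 'j, 'j, 'k) tensor3"
  have "(\<lambda>S. \<Sum>p \<in> {p. p permutes {0..<m}}. signof p * (\<Prod>i = 0..<m. S e (h i) (h (p i))))
      \<in> polynomial_functions I J J"
    by (intro polynomial_functions_sum polynomial_functions_prod polynomial_functions.intros
        finite_permutations e hJ) (auto dest: permutes_in_image)
  moreover have "F = (\<lambda>S. \<Sum>p \<in> {p. p permutes {0..<m}}.
      signof p * (\<Prod>i = 0..<m. S e (h i) (h (p i))))"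
  proof
    fix S :: "('i, 'j, 'j, 'k) tensor3"
    show "F S = (\<Sum>p \<in> {p. p permutes {0..<m}}.
      signof p * (\<Prod>i = 0..<m. S e (h i) (h (p i))))"
      unfolding F_def
      by (subst det_def'[of _ m]) (auto intro!: sum.cong prod.cong dest: permutes_in_image)
  qed
  ultimately have poly: "F \<in> polynomial_functions I J J" by simp
  \<comment> \<open>\<open>T\<close> lies in the closure belonging to its own rank, so the
    \<open>LEAST\<close> in \<open>border_rank\<close> is attained, namely at
    \<open>R\<close>.\<close>
  have "T \<in> zariski_closure I J J {S. tensor_rank I J J S \<le> tensor_rank I J J T}"
    by (auto simp: zariski_closure_def)
  then have "T \<in> zariski_closure I J J {S. tensor_rank I J J S \<le> R}"
    unfolding R_def border_rank_def by (rule LeastI)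
  moreover have "F S = 0" if "tensor_rank I J J S \<le> R" for S
  proof -
    obtain u v w where uvw: "\<forall>i\<in>I. \<forall>j\<in>J. \<forall>l\<in>J.
        S i j l = (\<Sum>s<tensor_rank I J J S. u s i * v s j * w s l)"
      using rank_le_tensor_rank[OF fin, of J S] unfolding rank_le_def by blast
    have "mat m m (\<lambda>(i, j). S e (h i) (h j))
        = mat m m (\<lambda>(i, j). \<Sum>s<tensor_rank I J J S. (u s e * v s (h i)) * w s (h j))"
      using uvw e hJ by (intro eq_matI) auto
    then show ?thesis
      unfolding F_def using that Rm
        det_low_rank[of "tensor_rank I J J S" m "\<lambda>s i. u s e * v s (h i)" "\<lambda>s j. w s (h j)"]
      by simp
  qed
  ultimately have "F T = 0"
    using poly by (auto simp: zariski_closure_def)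
  moreover have "mat m m (\<lambda>(i, j). T e (h i) (h j)) = 1\<^sub>m m"
    using h hJ slice by (intro eq_matI) (auto simp: bij_betw_def inj_on_def)
  ultimately show False
    by (simp add: F_def)
qed

section \<open>Reducing the number of evaluation points\<close>

text \<open>Gaussian elimination, one column at a time: a pivot row \<open>k0\<close> clears column
  \<open>d\<close> at the cost of one row, and the induction hypothesis treats the cleared matrix.
  In the application the rows are evaluation points.\<close>

lemma row_space_spanned_by_few_rows:
  fixes E :: "'x \<Rightarrow> 'd \<Rightarrow> 'k::field"
  assumes "finite D"
  shows "\<exists>Y\<subseteq>X. finite Y \<and> card Y \<le> card D \<and>
    (\<exists>c. \<forall>k\<in>X. \<forall>w\<in>D. E k w = (\<Sum>l\<in>Y. c k l * E l w))"
  using assms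
proof (induction D arbitrary: E rule: finite_induct)
  case empty
  show ?case by (rule exI[of _ "{}"]) simp
next
  case (insert d D)
  show ?case
  proof (cases "\<forall>k\<in>X. E k d = 0")
    case True
    obtain Y c where Y: "Y \<subseteq> X" "finite Y" "card Y \<le> card D"
      and c: "\<forall>k\<in>X. \<forall>w\<in>D. E k w = (\<Sum>l\<in>Y. c k l * E l w)"
      using insert.IH[of E] by auto
    have "E k d = (\<Sum>l\<in>Y. c k l * E l d)" if "k \<in> X" for k
      using True \<open>Y \<subseteq> X\<close> that by (simp add: subset_iff)
    then have "\<forall>k\<in>X. \<forall>w\<in>insert d D. E k w = (\<Sum>l\<in>Y. c k l * E l w)"
      using c by blast
    moreover have "card Y \<le> card (insert d D)"
      using Y insert.hyps by simp
    ultimately show ?thesis using Y by blast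
  next
    case False
    then obtain k0 where k0: "k0 \<in> X" "E k0 d \<noteq> 0" by blast
    define r where "r k = E k d / E k0 d" for k
    define E' where "E' k w = E k w - r k * E k0 w" for k w
    obtain Y c where Y: "Y \<subseteq> X" "finite Y" "card Y \<le> card D"
      and c: "\<forall>k\<in>X. \<forall>w\<in>D. E' k w = (\<Sum>l\<in>Y. c k l * E' l w)"
      using insert.IH[of E'] by auto
    have E'd: "E' k d = 0" for k
      using k0 by (simp add: E'_def r_def)
    \<comment> \<open>Substituting \<open>E' l = E l - r l * E k0\<close> into the relation for
      \<open>E' k\<close> gives these coefficients. They have two summands because \<open>k0\<close>
      may already belong to \<open>Y\<close>.\<close>
    define c' where "c' k l = (if l \<in> Y then c k l else 0)
        + (if l = k0 then r k - (\<Sum>l\<in>Y. c k l * r l) else 0)" for k l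
    have "E k w = (\<Sum>l\<in>insert k0 Y. c' k l * E l w)" if k: "k \<in> X" and w: "w \<in> insert d D" for k w
    proof -
      have "E' k w = (\<Sum>l\<in>Y. c k l * E' l w)"
      proof (cases "w = d")
        case True
        then show ?thesis by (simp add: E'd)
      next
        case False
        then show ?thesis using c k w by blast
      qed
      then have *: "E k w - r k * E k0 w = (\<Sum>l\<in>Y. c k l * E l w) - (\<Sum>l\<in>Y. c k l * r l) * E k0 w"
        by (simp add: E'_def right_diff_distrib sum_subtractf sum_distrib_right mult.assoc)
      have "(\<Sum>l\<in>insert k0 Y. c' k l * E l w)
          = (\<Sum>l\<in>insert k0 Y. if l \<in> Y then c k l * E l w else 0)
          + (\<Sum>l\<in>insert k0 Y. if l = k0 then (r k - (\<Sum>l\<in>Y. c k l * r l)) * E k0 w else 0)"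
        unfolding c'_def by (subst sum.distrib[symmetric]) (auto intro!: sum.cong simp: distrib_right)
      also have "(\<Sum>l\<in>insert k0 Y. if l \<in> Y then c k l * E l w else 0) = (\<Sum>l\<in>Y. c k l * E l w)"
        using Y by (intro sum.mono_neutral_cong_right) auto
      also have "(\<Sum>l\<in>insert k0 Y. if l = k0 then (r k - (\<Sum>l\<in>Y. c k l * r l)) * E k0 w else 0)
          = (r k - (\<Sum>l\<in>Y. c k l * r l)) * E k0 w"
        using Y by simp
      finally have "(\<Sum>l\<in>insert k0 Y. c' k l * E l w)
        = (\<Sum>l\<in>Y. c k l * E l w) + (r k - (\<Sum>l\<in>Y. c k l * r l)) * E k0 w" .
      moreover have "E k w = (\<Sum>l\<in>Y. c k l * E l w) + (r k - (\<Sum>l\<in>Y. c k l * r l)) * E k0 w"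
        using * by (simp add: algebra_simps)
      ultimately show ?thesis by simp
    qed
    moreover have "card (insert k0 Y) \<le> card (insert d D)"
      using Y insert.hyps by (simp add: card_insert_if)
    ultimately show ?thesis
      using Y k0 by (intro exI[of _ "insert k0 Y"]) auto
  qed
qed

text \<open>As functions of the point \<open>k\<close>, the products \<open>u k i * v k j\<close>
  lie in the span of \<open>card D\<close> functions, so their values on at most
  \<open>card D\<close> points determine them on \<open>X\<close>. The interpolation coefficients
  are absorbed into the third factor.\<close>

lemma rank_le_by_evaluation:
  fixes T :: "('i, 'j, 'l, 'k::field) tensor3"
  assumes "finite X" "finite D"
    and T: "\<And>i j l. i \<in> I \<Longrightarrow> j \<in> J \<Longrightarrow> l \<in> L \<Longrightarrow> T i j l = (\<Sum>k\<in>X. u k i * v k j * w k l)"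
    and span: "\<And>i j k. i \<in> I \<Longrightarrow> j \<in> J \<Longrightarrow> k \<in> X \<Longrightarrow>
      u k i * v k j = (\<Sum>d\<in>D. a i j d * E k d)"
  shows "tensor_rank I J L T \<le> card D"
proof -
  obtain Y c where Y: "Y \<subseteq> X" "finite Y" "card Y \<le> card D"
    and c: "\<forall>k\<in>X. \<forall>d\<in>D. E k d = (\<Sum>y\<in>Y. c k y * E y d)"
    using row_space_spanned_by_few_rows[OF \<open>finite D\<close>, of X E] by blast
  have "T i j l = (\<Sum>y\<in>Y. u y i * v y j * (\<Sum>k\<in>X. c k y * w k l))"
    if ijl: "i \<in> I" "j \<in> J" "l \<in> L" for i j l
  proof -
    have *: "u k i * v k j = (\<Sum>y\<in>Y. c k y * (u y i * v y j))" if k: "k \<in> X" for k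
    proof -
      have "u k i * v k j = (\<Sum>d\<in>D. a i j d * E k d)"
        using span ijl k by simp
      also have "\<dots> = (\<Sum>d\<in>D. a i j d * (\<Sum>y\<in>Y. c k y * E y d))"
        using c k by (metis (mono_tags, lifting) sum.cong)
      also have "\<dots> = (\<Sum>d\<in>D. \<Sum>y\<in>Y. c k y * (a i j d * E y d))"
        by (simp add: sum_distrib_left mult_ac)
      also have "\<dots> = (\<Sum>y\<in>Y. c k y * (\<Sum>d\<in>D. a i j d * E y d))"
        by (subst sum.swap) (simp add: sum_distrib_left)
      also have "\<dots> = (\<Sum>y\<in>Y. c k y * (u y i * v y j))"
        using span ijl \<open>Y \<subseteq> X\<close> by (intro sum.cong refl) (simp add: subset_iff)
      finally show ?thesis .
    qed
    have "T i j l = (\<Sum>k\<in>X. (\<Sum>y\<in>Y. c k y * (u y i * v y j)) * w k l)"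
      unfolding T[OF ijl] by (intro sum.cong refl arg_cong2[where f = times] *)
    also have "\<dots> = (\<Sum>k\<in>X. \<Sum>y\<in>Y. c k y * (u y i * v y j) * w k l)"
      by (simp add: sum_distrib_right)
    also have "\<dots> = (\<Sum>y\<in>Y. u y i * v y j * (\<Sum>k\<in>X. c k y * w k l))"
      by (subst sum.swap) (simp add: sum_distrib_left mult_ac)
    finally show ?thesis .
  qed
  then have "rank_le I J L T (card Y)"
    by (intro rank_le_sum) (use Y in auto)
  then show ?thesis
    using Y tensor_rank_le le_trans by blast
qed

section \<open>A filtered algebra degenerating to the Coppersmith--Winograd algebra\<close>

text \<open>The grading behind the blocking: for \<open>n \<noteq> 1\<close>,
  \<open>label12 n i\<close> is \<open>3 * CW_degree n i - 2\<close> and \<open>label3 n i\<close>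
  is \<open>4 - 3 * CW_degree n i\<close>.\<close>

definition CW_degree :: "nat \<Rightarrow> nat \<Rightarrow> nat" where
  "CW_degree n i = (if i = 1 then 0 else if i = n then 2 else 1)"

text \<open>The pairing into top degree: for \<open>n \<ge> 3\<close> and indices in
  \<open>{1..n}\<close>, the product of \<open>e_i\<close> and \<open>e_j\<close> has a component at
  \<open>e_n\<close> exactly when \<open>j = CW_dual n i\<close>. Degrees \<open>d\<close> and
  \<open>2 - d\<close> are exchanged.\<close>

definition CW_dual :: "nat \<Rightarrow> nat \<Rightarrow> nat" where
  "CW_dual n i = (if i = 1 then n else if i = n then 1 else i)"

text \<open>The functions \<open>f\<^sub>i\<close> with \<open>1 < i < n\<close> form the Helmert basis of the vectors of sum zero on the
  first \<open>n - 1\<close> points; the weight of the last point makes the constant function \<open>f\<^sub>1\<close> isotropic.\<close>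

lemma self_dual_basis:
  assumes n: "n \<ge> 3"
  obtains f :: "nat \<Rightarrow> nat \<Rightarrow> 'k::{alg_closed_field, field_char_0}" and lam :: "nat \<Rightarrow> 'k"
  where "\<And>k. f 1 k = 1"
    and "\<And>i j. i \<in> {1..n} \<Longrightarrow> j \<in> {1..n} \<Longrightarrow>
      (\<Sum>k=1..n. lam k * f i k * f j k) = (if j = CW_dual n i then 1 else 0)"
proof -
  \<comment> \<open>The Helmert vector with \<open>i - 1\<close> entries 1 followed by
    \<open>-(i - 1)\<close> has square norm \<open>(i - 1) * i\<close>; \<open>c i\<close>
    normalises it. For \<open>i \<le> 1\<close> the quotient is 0 by the convention on
    division.\<close>
  have "\<exists>c::'k. c ^ 2 = 1 / (of_nat (i - 1) * of_nat i)" for i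
    by (rule nth_root_exists) simp
  then obtain c :: "nat \<Rightarrow> 'k" where c: "\<And>i. c i ^ 2 = 1 / (of_nat (i - 1) * of_nat i)"
    by metis
  define m :: 'k where "m = of_nat (n - 1)"
  have m0: "m \<noteq> 0" using n by (simp add: m_def)
  define lam where "lam k = (if k = n then - m else 1)" for k
  \<comment> \<open>\<open>f n\<close> starts from \<open>-1 / m\<close> times the indicator of
    point \<open>n\<close>, which pairs to 1 with the constant function 1; adding the constant
    \<open>1 / (2 * m)\<close> makes it isotropic.\<close>
  define f where "f i k = (if i = 1 then 1 else if i = n then 1 / (2 * m) - (if k = n then 1 / m else 0)
      else if k < i then c i else if k = i then - of_nat (i - 1) * c i else 0)" for i k
  have phi: "(\<Sum>k=1..n. lam k * g k) = (\<Sum>k=1..n-1. g k) - m * g n" for g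
  proof -
    have "{1..n} = insert n {1..n-1}" using n by auto
    moreover have "(\<Sum>k=1..n-1. lam k * g k) = (\<Sum>k=1..n-1. g k)"
      using n by (intro sum.cong) (auto simp: lam_def)
    ultimately show ?thesis using n by (simp add: lam_def)
  qed
  have helmert: "(\<Sum>k=1..n-1. if k < i then a else if k = i then b else 0) = of_nat (i - 1) * a + b"
    if i: "2 \<le> i" "i < n" for i and a b :: 'k
  proof -
    have "(\<Sum>k=1..n-1. if k < i then a else if k = i then b else 0)
        = (\<Sum>k\<in>insert i {1..i-1}. if k < i then a else if k = i then b else 0)"
      using i by (intro sum.mono_neutral_right) auto
    also have "\<dots> = b + (\<Sum>k=1..i-1. if k < i then a else if k = i then b else 0)"
      using i by (subst sum.insert) auto
    also have "(\<Sum>k=1..i-1. if k < i then a else if k = i then b else 0) = (\<Sum>k=1..i-1. a)"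
      using i by (intro sum.cong) auto
    finally show ?thesis by simp
  qed
  define B where "B i j = (\<Sum>k=1..n. lam k * f i k * f j k)" for i j
  have B: "B i j = (\<Sum>k=1..n-1. f i k * f j k) - m * (f i n * f j n)" for i j
    unfolding B_def mult.assoc by (rule phi)
  have sym: "B i j = B j i" for i j
    by (simp add: B_def mult_ac)
  have one: "f 1 k = 1" "f (Suc 0) k = 1" for k by (simp_all add: f_def)
  have fn: "f n k = (if k = n then - (1 / (2 * m)) else 1 / (2 * m))" for k
    using n m0 by (simp add: f_def field_simps)
  have mid: "f i k = (if k < i then c i else if k = i then - of_nat (i - 1) * c i else 0)"
    if "2 \<le> i" "i < n" for i k
    using that by (simp add: f_def)
  have mid_sum: "(\<Sum>k=1..n-1. f i k) = 0" if i: "2 \<le> i" "i < n" for i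
    unfolding mid[OF i] helmert[OF i] by simp
  have fn_sum: "(\<Sum>k=1..n-1. f n k * g k) = 1 / (2 * m) * (\<Sum>k=1..n-1. g k)" for g
    unfolding sum_distrib_left using n by (intro sum.cong) (auto simp: fn)
  have B11: "B 1 1 = 0" by (simp add: B one m_def)
  have fn_tot: "(\<Sum>k=1..n-1. f n k) = 1 / 2"
    using fn_sum[of "\<lambda>_. 1"] m0 by (simp add: m_def)
  have fnn: "f n n = - (1 / (2 * m))"
    by (simp add: fn)
  have B1n: "B 1 n = 1"
    unfolding B one fnn mult_1_left fn_tot using m0 by simp
  have B1i: "B 1 i = 0" if "2 \<le> i" "i < n" for i
    using that mid_sum[OF that] by (simp add: B one mid)
  have Bnn: "B n n = 0"
    unfolding B fn_sum fn_tot fnn using m0 by (simp add: field_simps)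
  have Bni: "B n i = 0" if i: "2 \<le> i" "i < n" for i
    unfolding B fn_sum mid_sum[OF i] using i by (simp add: mid)
  have Bij: "B i j = 0" if ij: "2 \<le> i" "i < j" "j < n" for i j
  proof -
    \<comment> \<open>\<open>f i\<close> is supported on the points up to \<open>i\<close>, where
      \<open>f j\<close> has the constant value \<open>c j\<close>.\<close>
    have "f i k * f j k = c j * f i k" for k
      using ij by (simp add: mid)
    then have "(\<Sum>k=1..n-1. f i k * f j k) = c j * (\<Sum>k=1..n-1. f i k)"
      by (simp only: sum_distrib_left)
    then show ?thesis
      unfolding B using ij mid_sum[of i] by (simp add: mid)
  qed
  have Bii: "B i i = 1" if i: "2 \<le> i" "i < n" for i
  proof -
    have "f i k * f i k = (if k < i then c i ^ 2 else if k = i then of_nat (i - 1) ^ 2 * c i ^ 2 else 0)"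
      for k using i by (simp add: mid power2_eq_square algebra_simps)
    then have "B i i = of_nat (i - 1) * c i ^ 2 + of_nat (i - 1) ^ 2 * c i ^ 2"
      using i by (simp only: B helmert[OF i]) simp
    also have "\<dots> = of_nat (i - 1) * (of_nat (i - 1) + 1) * c i ^ 2"
      by (simp add: algebra_simps power2_eq_square)
    also have "(of_nat (i - 1) + 1 :: 'k) = of_nat i"
      using i by (simp add: of_nat_diff)
    finally show ?thesis
      using i by (simp add: c)
  qed
  have "B i j = (if j = CW_dual n i then 1 else 0)" if ij: "i \<in> {1..n}" "j \<in> {1..n}" for i j
  proof -
    have cases: "i = 1 \<or> i = n \<or> 2 \<le> i \<and> i < n" "j = 1 \<or> j = n \<or> 2 \<le> j \<and> j < n"
      using ij by auto
    consider "i = 1" | "j = 1" | "i = n" "j \<noteq> 1" | "j = n" "i \<noteq> 1"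
      | "2 \<le> i" "i < n" "2 \<le> j" "j < n" using cases by blast
    then show ?thesis
    proof cases
      case 5
      then show ?thesis
        using Bij[of i j] Bij[of j i] Bii[of i] sym[of i j]
        by (cases i j rule: linorder_cases) (auto simp: CW_dual_def)
    qed (use cases n B11 B1n B1i Bnn Bni sym in \<open>auto simp: CW_dual_def\<close>)
  qed
  then show ?thesis
    using that[of f lam] one by (simp add: B_def)
qed

text \<open>A right inverse of a square matrix is also a left inverse.\<close>

lemma dual_basis_swap:
  fixes a b :: "nat \<Rightarrow> nat \<Rightarrow> 'k::field"
  assumes "\<And>i j. i \<in> {1..n} \<Longrightarrow> j \<in> {1..n} \<Longrightarrow> (\<Sum>k=1..n. a i k * b k j) = (if i = j then 1 else 0)"
    and "i \<in> {1..n}" "j \<in> {1..n}"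
  shows "(\<Sum>k=1..n. b i k * a k j) = (if i = j then 1 else 0)"
proof -
  define A where "A = mat n n (\<lambda>(i, k). a (Suc i) (Suc k))"
  define B where "B = mat n n (\<lambda>(i, k). b (Suc i) (Suc k))"
  have A: "A \<in> carrier_mat n n" and B: "B \<in> carrier_mat n n"
    by (auto simp: A_def B_def)
  have shift: "(\<Sum>k\<in>{0..<n}. g (Suc k)) = (\<Sum>k=1..n. g k)" for g :: "nat \<Rightarrow> 'k"
    using sum.shift_bounds_Suc_ivl[of g 0 n] by (simp add: atLeastLessThanSuc_atLeastAtMost)
  have "A * B = 1\<^sub>m n"
  proof (rule eq_matI)
    fix i j assume "i < dim_row (1\<^sub>m n)" "j < dim_col (1\<^sub>m n)"
    then have ij: "i < n" "j < n" by auto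
    then have "(A * B) $$ (i, j) = (\<Sum>k\<in>{0..<n}. a (Suc i) (Suc k) * b (Suc k) (Suc j))"
      by (simp add: A_def B_def scalar_prod_def)
    then show "(A * B) $$ (i, j) = 1\<^sub>m n $$ (i, j)"
      using ij assms(1)[of "Suc i" "Suc j"] by (simp add: shift[of "\<lambda>k. a (Suc i) k * b k (Suc j)"])
  qed (use A B in auto)
  then have BA: "B * A = 1\<^sub>m n"
    by (rule mat_mult_left_right_inverse[OF A B])
  obtain i' j' where i': "i = Suc i'" "i' < n" and j': "j = Suc j'" "j' < n"
    using assms(2,3) by (cases i; cases j) auto
  have "(B * A) $$ (i', j') = (\<Sum>k\<in>{0..<n}. b (Suc i') (Suc k) * a (Suc k) (Suc j'))"
    using i' j' by (simp add: A_def B_def scalar_prod_def)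
  then show ?thesis
    using i' j' by (simp add: BA shift[of "\<lambda>k. b (Suc i') k * a k (Suc j')"])
qed

text \<open>\<open>CW n\<close> is homogeneous: the degrees in its support satisfy
  \<open>0 + d = d\<close>, \<open>d + 0 = d\<close> or \<open>1 + 1 = 2\<close>.\<close>

lemma CW_eq_0_if_degree:
  assumes "n \<ge> 3" "x \<in> {1..n}" "y \<in> {1..n}" "z \<in> {1..n}"
    and "CW_degree n z \<noteq> CW_degree n x + CW_degree n y"
  shows "CW n x y z = (0::'k::field)"
proof (rule ccontr)
  assume *: "CW n x y z \<noteq> (0::'k)"
  have "x = 1 \<and> y = z \<and> y \<in> {1..n} \<or> y = 1 \<and> x = z \<and> x \<in> {2..n}
        \<or> z = n \<and> x = y \<and> x \<in> {2..n-1}"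
    by (rule ccontr) (use * in \<open>simp only: CW_eq if_False simp_thms\<close>)
  then have "x = 1 \<and> y = z \<or> y = 1 \<and> x = z \<or> z = n \<and> x = y \<and> x \<noteq> 1 \<and> x \<noteq> n"
    using assms(1) by auto
  then show False
    using assms(1,5) by (elim disjE) (simp_all add: CW_degree_def)
qed

text \<open>\<open>t\<close> consists of the structure constants of pointwise multiplication on
  \<open>n\<close> points in the basis \<open>f\<close>, with dual basis \<open>g\<close>. Up to the
  weight, \<open>g z\<close> is a basis function of degree \<open>2 - CW_degree n z\<close>. Under
  the degree condition the three degrees add up to at most 2, so one function is constant and the
  sum reduces to the pairing. Thus \<open>t\<close> and \<open>CW n\<close> can differ only in terms
  of lower degree.\<close>

lemma CW_filtered_algebra:
  assumes n: "n \<ge> 3"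
  obtains t and f :: "nat \<Rightarrow> nat \<Rightarrow> 'k::{alg_closed_field, field_char_0}" and g
  where "\<forall>x y z. t x y z = (\<Sum>k=1..n. f x k * f y k * g z k)"
    and "\<forall>x\<in>{1..n}. \<forall>y\<in>{1..n}. \<forall>k\<in>{1..n}. f x k * f y k = (\<Sum>z=1..n. t x y z * f z k)"
    and "\<forall>x\<in>{1..n}. \<forall>y\<in>{1..n}. \<forall>z\<in>{1..n}.
      CW_degree n x + CW_degree n y \<le> CW_degree n z \<longrightarrow> t x y z = CW n x y z"
proof -
  obtain f :: "nat \<Rightarrow> nat \<Rightarrow> 'k" and lam where one: "\<And>k. f 1 k = 1"
    and pair: "\<And>i j. i \<in> {1..n} \<Longrightarrow> j \<in> {1..n} \<Longrightarrow>
      (\<Sum>k=1..n. lam k * f i k * f j k) = (if j = CW_dual n i then 1 else 0)"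
    using self_dual_basis[OF n] by blast
  define g where "g z k = lam k * f (CW_dual n z) k" for z k
  define t where "t x y z = (\<Sum>k=1..n. f x k * f y k * g z k)" for x y z
  have dual_in: "CW_dual n i \<in> {1..n}" if "i \<in> {1..n}" for i
    using that by (auto simp: CW_dual_def)
  have dual_eq: "CW_dual n i = CW_dual n j \<longleftrightarrow> i = j" for i j
    by (auto simp: CW_dual_def)
  have fg: "(\<Sum>k=1..n. f i k * g j k) = (if i = j then 1 else 0)"
    if ij: "i \<in> {1..n}" "j \<in> {1..n}" for i j
    using pair[OF ij(1) dual_in[OF ij(2)]] by (auto simp: dual_eq g_def mult_ac)
  \<comment> \<open>Biorthogonality gives completeness: every function on the points is expanded in
    \<open>f\<close> with coefficients computed by \<open>g\<close>.\<close>
  have gf: "(\<Sum>z=1..n. g z l * f z k) = (if l = k then 1 else 0)"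
    if "l \<in> {1..n}" "k \<in> {1..n}" for l k
    using dual_basis_swap[of n f "\<lambda>k z. g z k", OF fg that] .
  have expand: "f x k * f y k = (\<Sum>z=1..n. t x y z * f z k)" if k: "k \<in> {1..n}" for x y k
  proof -
    have "(\<Sum>z=1..n. t x y z * f z k) = (\<Sum>l=1..n. \<Sum>z=1..n. f x l * f y l * (g z l * f z k))"
      unfolding t_def sum_distrib_right by (subst sum.swap) (simp add: mult_ac)
    also have "\<dots> = (\<Sum>l=1..n. if l = k then f x k * f y k else 0)"
      unfolding sum_distrib_left[symmetric] using k gf by (intro sum.cong) auto
    finally show ?thesis using k by simp
  qed
  have CW: "t x y z = CW n x y z"
    if xyz: "x \<in> {1..n}" "y \<in> {1..n}" "z \<in> {1..n}"
      and le: "CW_degree n x + CW_degree n y \<le> CW_degree n z" for x y z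
  proof -
    \<comment> \<open>One of the three functions multiplied in \<open>t x y z\<close> has degree \<open>0\<close>, so it is \<open>f\<^sub>1 = 1\<close>.\<close>
    consider "x = 1" | "y = 1" | "z = n"
      using le by (auto simp: CW_degree_def split: if_splits)
    then show ?thesis
    proof cases
      case 1
      then show ?thesis
        using fg[of y z] xyz one n by (auto simp: t_def CW_eq)
    next
      case 2
      then show ?thesis
        using fg[of x z] xyz one n by (auto simp: t_def CW_eq)
    next
      case 3
      then have "g z k = lam k" for k
        using n one by (simp add: g_def CW_dual_def)
      then have "t x y z = (if y = CW_dual n x then 1 else 0)"
        using pair[of x y] xyz by (simp add: t_def mult_ac)
      then show ?thesis
        using 3 xyz n by (auto simp: CW_eq CW_dual_def)
    qed
  qed
  show ?thesis
  proof (rule that)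
    show "\<forall>x y z. t x y z = (\<Sum>k=1..n. f x k * f y k * g z k)"
      by (simp add: t_def)
    show "\<forall>x\<in>{1..n}. \<forall>y\<in>{1..n}. \<forall>k\<in>{1..n}. f x k * f y k = (\<Sum>z=1..n. t x y z * f z k)"
      by (intro ballI expand)
    show "\<forall>x\<in>{1..n}. \<forall>y\<in>{1..n}. \<forall>z\<in>{1..n}.
        CW_degree n x + CW_degree n y \<le> CW_degree n z \<longrightarrow> t x y z = CW n x y z"
      by (intro ballI impI CW)
  qed
qed

section \<open>Tensor powers\<close>

lemma power_index_0: "power_index A 0 = {[]}"
  by (auto simp: power_index_def)

lemma power_index_Suc: "power_index A (Suc N) = (\<lambda>(x, xs). x # xs) ` (A \<times> power_index A N)"
  by (auto simp: power_index_def length_Suc_conv image_iff)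

lemma finite_power_index: "finite A \<Longrightarrow> finite (power_index A N)"
  unfolding power_index_def using finite_lists_length_eq[of A N] by (simp add: conj_commute)

lemma card_power_index: "finite A \<Longrightarrow> card (power_index A N) = card A ^ N"
  unfolding power_index_def using card_lists_length_eq[of A N] by (simp add: conj_commute)

lemma power_index_nth: "xs \<in> power_index A N \<Longrightarrow> m < N \<Longrightarrow> xs ! m \<in> A"
  by (auto simp: power_index_def)

text \<open>Distributivity, which carries identities for a single factor over to the tensor
  power.\<close>

lemma prod_sum_power_index:
  fixes h :: "nat \<Rightarrow> 'a \<Rightarrow> 'k::comm_semiring_1"
  shows "(\<Prod>m<N. \<Sum>x\<in>A. h m x) = (\<Sum>xs\<in>power_index A N. \<Prod>m<N. h m (xs ! m))"
proof (induction N arbitrary: h)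
  case 0
  show ?case by (simp add: power_index_0)
next
  case (Suc N)
  have "(\<Sum>xs\<in>power_index A (Suc N). \<Prod>m<Suc N. h m (xs ! m))
      = (\<Sum>(x, xs)\<in>A \<times> power_index A N. h 0 x * (\<Prod>m<N. h (Suc m) (xs ! m)))"
    unfolding power_index_Suc
    by (subst sum.reindex)
      (auto simp: inj_on_def case_prod_unfold prod.lessThan_Suc_shift simp del: prod.lessThan_Suc)
  also have "\<dots> = (\<Sum>x\<in>A. h 0 x) * (\<Prod>m<N. \<Sum>x\<in>A. h (Suc m) x)"
    by (simp add: Suc sum_product sum.cartesian_product)
  also have "\<dots> = (\<Prod>m<Suc N. \<Sum>x\<in>A. h m x)"
    by (simp add: prod.lessThan_Suc_shift del: prod.lessThan_Suc)
  finally show ?case ..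
qed

text \<open>The positions of \<open>a\<close> are chosen first; every other position has
  \<open>card A - 1\<close> values. Splitting off the head reduces this to Pascal's rule.\<close>

lemma card_lists_count:
  assumes A: "finite A" "a \<in> A"
  shows "card {xs \<in> power_index A N. count_list xs a = c} = (N choose c) * (card A - 1) ^ (N - c)"
proof (induction N arbitrary: c)
  case 0
  have "{xs \<in> power_index A 0. count_list xs a = c} = (if c = 0 then {[]} else {})"
    by (auto simp: power_index_0)
  then show ?case by simp
next
  case (Suc N)
  let ?S = "\<lambda>N c. {xs \<in> power_index A N. count_list xs a = c}"
  let ?other = "(\<lambda>(x, xs). x # xs) ` ((A - {a}) \<times> ?S N c)"
  have card_other: "card ?other = (card A - 1) * ((N choose c) * (card A - 1) ^ (N - c))"
    using A by (subst card_image) (auto simp: inj_on_def Suc card_cartesian_product)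
  have fin: "finite (?S N c)" for c
    using finite_power_index[OF A(1)] by simp
  show ?case
  proof (cases c)
    case 0
    then have "?S (Suc N) c = ?other"
      using A by (auto simp: power_index_Suc image_iff split: if_splits)
    then show ?thesis using card_other 0 by simp
  next
    case (Suc c')
    have decomp: "?S (Suc N) c = ((#) a) ` ?S N c' \<union> ?other"
      using A Suc by (auto simp: power_index_Suc image_iff split: if_splits)
    have "card (?S (Suc N) c) = card (((#) a) ` ?S N c') + card ?other"
      unfolding decomp using fin A by (intro card_Un_disjoint) auto
    also have "card (((#) a) ` ?S N c') = (N choose c') * (card A - 1) ^ (N - c')"
      by (subst card_image) (auto simp: Suc.IH)
    finally have *: "card (?S (Suc N) c) = (N choose c') * (card A - 1) ^ (N - c')
        + (card A - 1) * ((N choose c) * (card A - 1) ^ (N - c))"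
      unfolding card_other .
    show ?thesis
    proof (cases "c \<le> N")
      case True
      then have "N - c' = Suc (N - Suc c')"
        using Suc by simp
      moreover obtain r where "card A = Suc r"
        using A by (cases "card A") auto
      ultimately show ?thesis
        unfolding * using Suc by (simp add: algebra_simps)
    next
      case False
      then show ?thesis
        unfolding * using Suc by simp
    qed
  qed
qed

section \<open>Degrees of words and the rank of a graded piece\<close>

definition list_degree :: "nat \<Rightarrow> nat list \<Rightarrow> nat" where
  "list_degree n xs = sum_list (map (CW_degree n) xs)"

lemma list_degree_nth:
  "xs \<in> power_index A N \<Longrightarrow> list_degree n xs = (\<Sum>m<N. CW_degree n (xs ! m))"
  by (auto simp: list_degree_def power_index_def sum_list_sum_nth atLeast0LessThan)

lemma two_count_le_list_degree: "n \<noteq> 1 \<Longrightarrow> 2 * count_list xs n \<le> list_degree n xs"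
  by (induction xs) (auto simp: list_degree_def CW_degree_def)

text \<open>In degrees \<open>(a, b, a + b)\<close> the power of \<open>CW n\<close> agrees with
  that of \<open>t\<close>, which evaluation at points decomposes into rank-one terms. Products of
  functions of degrees \<open>a\<close> and \<open>b\<close> lie in the span of the basis functions
  of degree at most \<open>a + b\<close>, so \<open>rank_le_by_evaluation\<close> applies. The
  selections \<open>P\<close>, \<open>Q\<close>, \<open>R\<close> only set entries of the factors to
  0.\<close>

lemma tensor_rank_graded_piece_le:
  fixes n N :: nat and S :: "(nat list, nat list, nat list, 'k::{alg_closed_field, field_char_0}) tensor3"
  assumes n: "n \<ge> 3"
  defines "V \<equiv> power_index {1..n} N"
  assumes S: "\<And>xs ys zs. xs \<in> V \<Longrightarrow> ys \<in> V \<Longrightarrow> zs \<in> V \<Longrightarrow>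
      S xs ys zs = (if P xs \<and> Q ys \<and> R zs then kronecker_power (CW n) N xs ys zs else 0)"
    and P: "\<And>xs. xs \<in> V \<Longrightarrow> P xs \<Longrightarrow> list_degree n xs = a"
    and Q: "\<And>ys. ys \<in> V \<Longrightarrow> Q ys \<Longrightarrow> list_degree n ys = b"
    and R: "\<And>zs. zs \<in> V \<Longrightarrow> R zs \<Longrightarrow> list_degree n zs = a + b"
  shows "tensor_rank V V V S \<le> card {ws \<in> V. list_degree n ws \<le> a + b}"
proof -
  obtain t and f :: "nat \<Rightarrow> nat \<Rightarrow> 'k" and g
    where t: "\<forall>x y z. t x y z = (\<Sum>k=1..n. f x k * f y k * g z k)"
      and expand: "\<forall>x\<in>{1..n}. \<forall>y\<in>{1..n}. \<forall>k\<in>{1..n}.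
        f x k * f y k = (\<Sum>z=1..n. t x y z * f z k)"
      and t_CW: "\<forall>x\<in>{1..n}. \<forall>y\<in>{1..n}. \<forall>z\<in>{1..n}.
        CW_degree n x + CW_degree n y \<le> CW_degree n z \<longrightarrow> t x y z = CW n x y z"
    by (rule CW_filtered_algebra[OF n]) (rule that)
  have finV: "finite V"
    by (simp add: V_def finite_power_index)
  have VD: "xs ! m \<in> {1..n}" if "xs \<in> V" "m < N" for xs m
    using that power_index_nth unfolding V_def by blast
  let ?D = "\<lambda>xs. \<Sum>m<N. CW_degree n (xs ! m)"
  have deg: "list_degree n xs = ?D xs" if "xs \<in> V" for xs
    using that unfolding V_def by (rule list_degree_nth)
  \<comment> \<open>Where the third degree exceeds the sum of the other two, \<open>t\<close> agrees
    with \<open>CW n\<close>, which vanishes there by homogeneity.\<close>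
  have excess: "t (xs ! m) (ys ! m) (zs ! m) = 0 \<and> CW n (xs ! m) (ys ! m) (zs ! m) = (0::'k)"
    if "xs \<in> V" "ys \<in> V" "zs \<in> V" "m < N"
      "CW_degree n (xs ! m) + CW_degree n (ys ! m) < CW_degree n (zs ! m)" for xs ys zs m
    using t_CW[rule_format, of "xs ! m" "ys ! m" "zs ! m"] CW_eq_0_if_degree[OF n, of "xs ! m" "ys ! m" "zs ! m"]
      that VD by simp
  have t_zero: "(\<Prod>m<N. t (xs ! m) (ys ! m) (ws ! m)) = 0"
    if V: "xs \<in> V" "ys \<in> V" "ws \<in> V" and less: "?D xs + ?D ys < ?D ws" for xs ys ws
  proof -
    have "\<not> (\<forall>m<N. CW_degree n (ws ! m) \<le> CW_degree n (xs ! m) + CW_degree n (ys ! m))"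
      using less sum_mono[of "{..<N}" "\<lambda>m. CW_degree n (ws ! m)"
          "\<lambda>m. CW_degree n (xs ! m) + CW_degree n (ys ! m)"]
      by (fastforce simp: sum.distrib)
    then obtain m where "m < N" "CW_degree n (xs ! m) + CW_degree n (ys ! m) < CW_degree n (ws ! m)"
      by (auto simp: not_le)
    then have "t (xs ! m) (ys ! m) (ws ! m) = 0"
      using excess V by blast
    then show ?thesis
      using \<open>m < N\<close> by (intro prod_zero) auto
  qed
  have t_power: "(\<Prod>m<N. t (xs ! m) (ys ! m) (zs ! m)) = kronecker_power (CW n) N xs ys zs"
    if V: "xs \<in> V" "ys \<in> V" "zs \<in> V" and eq: "?D zs = ?D xs + ?D ys" for xs ys zs
  proof (cases "\<forall>m<N. CW_degree n (xs ! m) + CW_degree n (ys ! m) \<le> CW_degree n (zs ! m)")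
    case True
    then show ?thesis
      unfolding kronecker_power_def using V VD by (intro prod.cong) (auto intro!: t_CW[rule_format])
  next
    case False
    then obtain m0 where m0: "m0 < N" "CW_degree n (zs ! m0) < CW_degree n (xs ! m0) + CW_degree n (ys ! m0)"
      by (auto simp: not_le)
    \<comment> \<open>The total degrees agree, so a deficit at \<open>m0\<close> forces an excess at
      some other position, where both \<open>t\<close> and \<open>CW n\<close> vanish.\<close>
    have "\<not> (\<forall>m<N. CW_degree n (zs ! m) \<le> CW_degree n (xs ! m) + CW_degree n (ys ! m))"
    proof
      assume "\<forall>m<N. CW_degree n (zs ! m) \<le> CW_degree n (xs ! m) + CW_degree n (ys ! m)"
      then have "?D zs < (\<Sum>m<N. CW_degree n (xs ! m) + CW_degree n (ys ! m))"
        using m0 by (intro sum_strict_mono_ex1) auto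
      then show False using eq by (simp add: sum.distrib)
    qed
    then obtain m where m: "m < N" "CW_degree n (xs ! m) + CW_degree n (ys ! m) < CW_degree n (zs ! m)"
      by (auto simp: not_le)
    have "(\<Prod>m<N. t (xs ! m) (ys ! m) (zs ! m)) = 0"
      using m excess[OF V m] by (intro prod_zero) auto
    moreover have "kronecker_power (CW n) N xs ys zs = (0::'k)"
      unfolding kronecker_power_def using m excess[OF V m] by (intro prod_zero) auto
    ultimately show ?thesis by simp
  qed
  \<comment> \<open>The words in \<open>V\<close> also serve as points: \<open>E ks ws\<close> below
    is the value at the point \<open>ks\<close> of the product function indexed by
    \<open>ws\<close>.\<close>
  define u where "u ks xs = (if P xs then \<Prod>m<N. f (xs ! m) (ks ! m) else 0)" for ks xs
  define v where "v ks ys = (if Q ys then \<Prod>m<N. f (ys ! m) (ks ! m) else 0)" for ks ys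
  define w where "w ks zs = (if R zs then \<Prod>m<N. g (zs ! m) (ks ! m) else 0)" for ks zs
  define E where "E ks ws = (\<Prod>m<N. f (ws ! m) (ks ! m))" for ks ws
  define c where "c xs ys ws = (if P xs \<and> Q ys then \<Prod>m<N. t (xs ! m) (ys ! m) (ws ! m) else 0)"
    for xs ys ws
  show ?thesis
  proof (rule rank_le_by_evaluation[where X = V and u = u and v = v and w = w and E = E and a = c])
    fix xs ys zs assume V: "xs \<in> V" "ys \<in> V" "zs \<in> V"
    show "S xs ys zs = (\<Sum>ks\<in>V. u ks xs * v ks ys * w ks zs)"
    proof (cases "P xs \<and> Q ys \<and> R zs")
      case True
      have "kronecker_power (CW n) N xs ys zs = (\<Prod>m<N. t (xs ! m) (ys ! m) (zs ! m))"
        using True V P[of xs] Q[of ys] R[of zs] deg by (intro t_power[symmetric]) simp_all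
      also have "\<dots> = (\<Sum>ks\<in>V. \<Prod>m<N. f (xs ! m) (ks ! m) * f (ys ! m) (ks ! m) * g (zs ! m) (ks ! m))"
        unfolding t[rule_format] V_def by (rule prod_sum_power_index)
      also have "\<dots> = (\<Sum>ks\<in>V. u ks xs * v ks ys * w ks zs)"
        using True by (simp add: u_def v_def w_def prod.distrib)
      finally show ?thesis
        using True V S by simp
    next
      case False
      then show ?thesis
        using V S by (auto simp: u_def v_def w_def intro!: sum.neutral)
    qed
  next
    fix xs ys ks assume V: "xs \<in> V" "ys \<in> V" "ks \<in> V"
    let ?low = "{ws \<in> V. list_degree n ws \<le> a + b}"
    show "u ks xs * v ks ys = (\<Sum>ws\<in>?low. c xs ys ws * E ks ws)"
    proof (cases "P xs \<and> Q ys")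
      case True
      have "u ks xs * v ks ys = (\<Prod>m<N. f (xs ! m) (ks ! m) * f (ys ! m) (ks ! m))"
        using True by (simp add: u_def v_def prod.distrib)
      also have "\<dots> = (\<Prod>m<N. \<Sum>z=1..n. t (xs ! m) (ys ! m) z * f z (ks ! m))"
        using V VD by (intro prod.cong refl expand[rule_format]) auto
      also have "\<dots> = (\<Sum>ws\<in>V. \<Prod>m<N. t (xs ! m) (ys ! m) (ws ! m) * f (ws ! m) (ks ! m))"
        unfolding V_def by (rule prod_sum_power_index)
      also have "\<dots> = (\<Sum>ws\<in>V. c xs ys ws * E ks ws)"
        using True by (simp add: c_def E_def prod.distrib)
      also have "\<dots> = (\<Sum>ws\<in>?low. c xs ys ws * E ks ws)"
      proof (rule sum.mono_neutral_right)
        show "\<forall>ws\<in>V - ?low. c xs ys ws * E ks ws = 0"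
        proof
          fix ws assume "ws \<in> V - ?low"
          then have "?D xs + ?D ys < ?D ws" "ws \<in> V"
            using V True P Q deg by (auto simp: not_le)
          then show "c xs ys ws * E ks ws = 0"
            using V t_zero by (simp add: c_def)
        qed
      qed (use finV in auto)
      finally show ?thesis .
    next
      case False
      then show ?thesis by (auto simp: u_def v_def c_def)
    qed
  qed (use finV in auto)
qed

section \<open>The sweet piece\<close>

lemma sum_list_labels:
  "set ls \<subseteq> {-2, 1, 4} \<Longrightarrow>
    sum_list ls = 4 * int (count_list ls 4) + int (count_list ls 1) - 2 * int (count_list ls (-2))"
  by (induction ls) auto

lemma sum_list_label12:
  "n \<noteq> 1 \<Longrightarrow> sum_list (map (label12 n) xs) = 3 * int (list_degree n xs) - 2 * int (length xs)"
  by (induction xs) (auto simp: list_degree_def label12_def CW_degree_def)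

lemma sum_list_label3:
  "n \<noteq> 1 \<Longrightarrow> sum_list (map (label3 n) xs) = 4 * int (length xs) - 3 * int (list_degree n xs)"
  by (induction xs) (auto simp: list_degree_def label3_def CW_degree_def)

text \<open>Each marginal has mean \<open>-2 * (p + 2 * q) + 2 * p + 4 * q = 0\<close>. As labels
  are affine in the degree, this fixes the degree of every word kept by the sweet piece.\<close>

lemma sum_list_labels_eq_0:
  assumes "CW_distribution p q P" "f \<in> {fst, fst \<circ> snd, snd \<circ> snd}"
    and "has_label_type lab (map_pmf f P) N xs" "range lab \<subseteq> {-2, 1, 4}"
  shows "sum_list (map lab xs) = 0"
proof -
  let ?c = "\<lambda>a. real (count_list (map lab xs) a)"
  have c: "?c (-2) = (p + 2 * q) * N" "?c 1 = 2 * p * N" "?c 4 = q * N"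
    using assms(3) CW_distribution_marginals[OF assms(1,2)] by (simp_all add: has_label_type_def)
  have "set (map lab xs) \<subseteq> {-2, 1, 4}"
    using assms(4) by auto
  then have "real_of_int (sum_list (map lab xs)) = 4 * ?c 4 + ?c 1 - 2 * ?c (-2)"
    by (simp only: sum_list_labels of_int_add of_int_diff of_int_mult of_int_of_nat_eq of_int_numeral)
  then show ?thesis
    unfolding c by (simp add: algebra_simps)
qed

text \<open>Words with exactly \<open>2 * M + 1\<close> letters \<open>n\<close> have degree at
  least \<open>4 * M + 2\<close>, and the left side is their number. Strictness comes from a word of
  degree \<open>4 * M + 1\<close> outside this count.\<close>

lemma card_high_degree:
  assumes n: "n \<ge> 3" and "M \<ge> 1"
  shows "((3 * M) choose (2 * M + 1)) * (n - 1) ^ (M - 1)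
    < card {ws \<in> power_index {1..n} (3 * M). \<not> list_degree n ws \<le> 4 * M}"
proof -
  let ?C = "{ws \<in> power_index {1..n} (3 * M). count_list ws n = 2 * M + 1}"
  let ?H = "{ws \<in> power_index {1..n} (3 * M). \<not> list_degree n ws \<le> 4 * M}"
  \<comment> \<open>Length \<open>3 * M\<close> and degree \<open>4 * M + 1\<close>, since the
    letter 2 has degree 1 for \<open>n \<ge> 3\<close>, but only \<open>2 * M\<close> letters
    \<open>n\<close>.\<close>
  define ws where "ws = replicate (2 * M) n @ [2] @ replicate (M - 1) 1"
  have "ws \<in> ?H"
    using assms by (auto simp: ws_def power_index_def list_degree_def CW_degree_def sum_list_replicate)
  moreover have "ws \<notin> ?C"
    using n by (simp add: ws_def count_list_0_iff flip: count_mset)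
  moreover have "?C \<subseteq> ?H"
  proof
    fix xs assume "xs \<in> ?C"
    then show "xs \<in> ?H"
      using two_count_le_list_degree[of n xs] n by auto
  qed
  ultimately have "?C \<subset> ?H" by blast
  then have "card ?C < card ?H"
    by (intro psubset_card_mono) (simp_all add: finite_power_index)
  moreover have "3 * M - (2 * M + 1) = M - 1" by simp
  ultimately show ?thesis
    using card_lists_count[of "{1..n}" n "3 * M" "2 * M + 1"] n by simp
qed

text \<open>The slice of \<open>CW n\<close> at the unit \<open>e_1\<close> is the identity matrix,
  so the slice of the power at the word of ones is the identity of size
  \<open>n ^ N\<close>.\<close>

lemma border_rank_CW_power_ge:
  fixes n N :: nat
  assumes "n \<ge> 1"
  defines "V \<equiv> power_index {1..n} N"
  shows "n ^ N \<le> border_rank V V V (kronecker_power (CW n) N ::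
    (nat list, nat list, nat list, 'k::field) tensor3)"
proof -
  have "card V \<le> border_rank V V V (kronecker_power (CW n) N ::
    (nat list, nat list, nat list, 'k) tensor3)"
  proof (rule border_rank_ge_identity_slice)
    show "finite V" "finite V"
      by (simp_all add: V_def finite_power_index)
    show "replicate N 1 \<in> V"
      using assms by (auto simp: V_def power_index_def)
    fix ys zs assume yz: "ys \<in> V" "zs \<in> V"
    have CW1: "CW n 1 y z = (if y = z then 1 else (0::'k))" if "y \<in> {1..n}" for y z
      using that by (auto simp: CW_eq)
    have "kronecker_power (CW n) N (replicate N 1) ys zs = (\<Prod>m<N. if ys ! m = zs ! m then 1 else (0::'k))"
      unfolding kronecker_power_def
    proof (rule prod.cong)
      fix m assume "m \<in> {..<N}"
      then show "CW n (replicate N 1 ! m) (ys ! m) (zs ! m) = (if ys ! m = zs ! m then 1 else (0::'k))"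
        using CW1[of "ys ! m" "zs ! m"] power_index_nth[OF yz(1)[unfolded V_def], of m] by simp
    qed simp
    also have "\<dots> = (if ys = zs then 1 else 0)"
    proof (cases "ys = zs")
      case False
      then obtain m where "m < N" "ys ! m \<noteq> zs ! m"
        using yz by (auto simp: V_def power_index_def list_eq_iff_nth_eq)
      then have "(\<Prod>m<N. if ys ! m = zs ! m then 1 else (0::'k)) = 0"
        by (intro prod_zero) auto
      then show ?thesis using False by simp
    qed simp
    finally show "kronecker_power (CW n) N (replicate N 1) ys zs = (if ys = zs then 1 else (0::'k))" .
  qed
  then show ?thesis
    by (simp add: V_def card_power_index)
qed

theorem proposition1p18:
  fixes n N :: nat and p q :: real and P :: "(int \<times> int \<times> int) pmf"
  assumes "n \<ge> 3"
    and "p \<ge> 0" and "q \<ge> 0" and "3 * p + 3 * q = 1"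
    and "N \<ge> 1" and "p * real N \<in> \<int>" and "q * real N \<in> \<int>"
    and "CW_distribution p q P"
  defines "V \<equiv> power_index {1..n} N"
    and "SP \<equiv> (sweet_piece P N n ::
          (nat list, nat list, nat list, 'k :: {alg_closed_field, field_char_0}) tensor3)"
    and "T \<equiv> (kronecker_power (CW n) N :: (nat list, nat list, nat list, 'k) tensor3)"
  shows "real (tensor_rank V V V SP) <
           real n ^ N
           - real (N choose nat \<lfloor>(2 * p + 2 * q) * real N + 1\<rfloor>)
             * (real n - 1) ^ nat \<lfloor>(p + q) * real N - 1\<rfloor>
       \<and> tensor_rank V V V SP < border_rank V V V T"
proof -
  \<comment> \<open>Since \<open>p + q = 1/3\<close>, the integer \<open>(p + q) * N\<close> is
    \<open>N / 3\<close>; it becomes \<open>M\<close>, in terms of which the bound is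
    rewritten.\<close>
  have "p * real N + q * real N \<in> \<int>"
    using assms(6,7) by (rule Ints_add)
  then have "(p + q) * real N \<in> \<int>" "(p + q) * real N \<ge> 0"
    using assms(2,3) by (auto simp: distrib_right)
  then obtain M where M: "(p + q) * real N = real M"
    by (metis Ints_cases of_int_0_le_iff of_int_of_nat_eq nonneg_int_cases)
  have "real N = (3 * p + 3 * q) * real N"
    by (simp add: assms(4))
  also have "\<dots> = 3 * real M"
    using M by (simp add: algebra_simps)
  finally have N: "N = 3 * M" by linarith
  have M1: "M \<ge> 1" using N assms(5) by simp
  have "(2 * p + 2 * q) * real N + 1 = real (2 * M + 1)"
    using M by (simp add: algebra_simps)
  then have exp1: "nat \<lfloor>(2 * p + 2 * q) * real N + 1\<rfloor> = 2 * M + 1"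
    by (simp only: floor_of_nat nat_int)
  have "(p + q) * real N - 1 = real (M - 1)"
    using M M1 by (simp add: of_nat_diff)
  then have exp2: "nat \<lfloor>(p + q) * real N - 1\<rfloor> = M - 1"
    by (simp only: floor_of_nat nat_int)
  have len: "length xs = N" if "xs \<in> V" for xs
    using that by (simp add: V_def power_index_def)
  have n1: "n \<noteq> 1" using assms(1) by simp
  have range12: "range (label12 n) \<subseteq> {-2, 1, 4}" and range3: "range (label3 n) \<subseteq> {-2, 1, 4}"
    by (auto simp: label12_def label3_def)
  let ?low = "{ws \<in> V. list_degree n ws \<le> 4 * M}"
  let ?high = "{ws \<in> V. \<not> list_degree n ws \<le> 4 * M}"
  \<comment> \<open>Label sum 0 means degree \<open>2 * N / 3 = 2 * M\<close> in the first two
    factors and \<open>4 * N / 3 = 4 * M\<close> in the third, so the graded-piece bound applies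
    with \<open>a = b = 2 * M\<close>.\<close>
  have "tensor_rank V V V SP \<le> card {ws \<in> V. list_degree n ws \<le> 2 * M + 2 * M}"
  proof (rule tensor_rank_graded_piece_le[OF assms(1), where N = N
        and P = "has_label_type (label12 n) (map_pmf fst P) N"
        and Q = "has_label_type (label12 n) (map_pmf (fst \<circ> snd) P) N"
        and R = "has_label_type (label3 n) (map_pmf (snd \<circ> snd) P) N", folded V_def])
    show "list_degree n xs = 2 * M" if "xs \<in> V" "has_label_type (label12 n) (map_pmf fst P) N xs" for xs
      using sum_list_labels_eq_0[OF assms(8) _ that(2) range12] sum_list_label12[OF n1, of xs]
        len[OF that(1)] N by simp
    show "list_degree n xs = 2 * M"
      if "xs \<in> V" "has_label_type (label12 n) (map_pmf (fst \<circ> snd) P) N xs" for xs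
      using sum_list_labels_eq_0[OF assms(8) _ that(2) range12] sum_list_label12[OF n1, of xs]
        len[OF that(1)] N by simp
    show "list_degree n xs = 2 * M + 2 * M"
      if "xs \<in> V" "has_label_type (label3 n) (map_pmf (snd \<circ> snd) P) N xs" for xs
      using sum_list_labels_eq_0[OF assms(8) _ that(2) range3] sum_list_label3[OF n1, of xs]
        len[OF that(1)] N by simp
  qed (simp add: SP_def sweet_piece_def)
  then have rank: "tensor_rank V V V SP \<le> card ?low" by simp
  have finV: "finite V" by (simp add: V_def finite_power_index)
  have "card V = card ?low + card ?high"
    using finV by (subst card_Un_disjoint[symmetric]) (auto intro!: arg_cong[where f = card])
  then have total: "card ?low + card ?high = n ^ N"
    by (simp add: V_def card_power_index)
  have high: "(N choose (2 * M + 1)) * (n - 1) ^ (M - 1) < card ?high"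
    unfolding V_def N by (rule card_high_degree[OF assms(1) M1])
  have "tensor_rank V V V SP + (N choose (2 * M + 1)) * (n - 1) ^ (M - 1) < n ^ N"
    using rank total high by linarith
  then have "real (tensor_rank V V V SP + (N choose (2 * M + 1)) * (n - 1) ^ (M - 1)) < real (n ^ N)"
    by (rule of_nat_less_iff[THEN iffD2])
  moreover have "real (n - 1) = real n - 1"
    using assms(1) by simp
  ultimately have "real (tensor_rank V V V SP) <
      real n ^ N - real (N choose (2 * M + 1)) * (real n - 1) ^ (M - 1)"
    by simp
  moreover have "n ^ N \<le> border_rank V V V T"
    unfolding V_def T_def using assms(1) by (intro border_rank_CW_power_ge) simp
  then have "tensor_rank V V V SP < border_rank V V V T"
    using rank total high by linarith
  ultimately show ?thesis
    unfolding exp1 exp2 by blast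
qed

end
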